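(* For every $\tau\in\mathbb{H}^2$, $$\frac{\theta'[\frac15,\frac15]}{\theta[\frac15,\frac15]}=\theta'[1,1]\,\frac{\theta^5[\frac15,\frac15]-3\zeta_5^4\,\theta^5[\frac35,\frac35]}{10\,\theta^3[\frac15,\frac15]\,\theta^3[\frac35,\frac35]},\qquad \frac{\theta'[\frac35,\frac35]}{\theta[\frac35,\frac35]}=\theta'[1,1]\,\frac{3\,\theta^5[\frac15,\frac15]+\zeta_5^4\,\theta^5[\frac35,\frac35]}{10\,\theta^3[\frac15,\frac15]\,\theta^3[\frac35,\frac35]}.$$
   Context: $\mathbb{H}^2=\{\tau\in\mathbb{C} : \Im\tau>0\}$ is the upper half plane and $\zeta_k=\exp(2\pi i/k)$. For $\epsilon,\epsilon'\in\mathbb{R}$, $\zeta\in\mathbb{C}$, $\tau\in\mathbb{H}^2$, the theta function with characteristics is $$\theta[\epsilon,\epsilon'](\zeta,\tau)=\sum_{n\in\mathbb{Z}}\exp\left(2\pi i\left[\tfrac12\left(n+\tfrac{\epsilon}{2}\right)^2\tau+\left(n+\tfrac{\epsilon}{2}\right)\left(\zeta+\tfrac{\epsilon'}{2}\right)\right]\right).$$ Write $\theta[\epsilon,\epsilon']=\theta[\epsilon,\epsilon'](0,\tau)$ and $\theta'[\epsilon,\epsilon']=\frac{\partial}{\partial\zeta}\theta[\epsilon,\epsilon'](\zeta,\tau)\big|_{\zeta=0}$; $\theta^k[\epsilon,\epsilon']$ means the $k$-th power of $\theta[\epsilon,\epsilon']$. *)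

theory Defs
  imports "HOL-Analysis.Analysis"
begin

definition zeta_root :: "nat \<Rightarrow> complex" where
  "zeta_root k = exp (2 * of_real pi * \<i> / of_nat k)"

definition theta :: "real \<Rightarrow> real \<Rightarrow> complex \<Rightarrow> complex \<Rightarrow> complex" where
  "theta \<epsilon> \<epsilon>' \<zeta> \<tau> =
     (\<Sum>\<^sub>\<infinity>n\<in>(UNIV :: int set).
        exp (2 * of_real pi * \<i> *
          (1 / 2 * (of_int n + of_real \<epsilon> / 2) ^ 2 * \<tau>
           + (of_int n + of_real \<epsilon> / 2) * (\<zeta> + of_real \<epsilon>' / 2))))"

definition theta_const :: "real \<Rightarrow> real \<Rightarrow> complex \<Rightarrow> complex" where
  "theta_const \<epsilon> \<epsilon>' \<tau> = theta \<epsilon> \<epsilon>' 0 \<tau>"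

definition theta_deriv :: "real \<Rightarrow> real \<Rightarrow> complex \<Rightarrow> complex" where
  "theta_deriv \<epsilon> \<epsilon>' \<tau> = deriv (\<lambda>\<zeta>. theta \<epsilon> \<epsilon>' \<zeta> \<tau>) 0"

end

theory Submission
  imports Defs "HOL-Complex_Analysis.Complex_Analysis"
begin

text \<open>
  Write \<open>f\<close> for the odd function \<open>z \<mapsto> theta 1 1 z \<tau>\<close>, \<open>J = f' / f\<close> for its logarithmic derivative and
  \<open>w = (\<tau> + 1) / 5\<close>. The constants \<open>theta_const (3/5) (3/5)\<close> and \<open>theta_const (1/5) (1/5)\<close> are, up to
  exponential factors, the values of \<open>f\<close> at \<open>- w\<close> and \<open>- 2 * w\<close>. The core of the proof is the identity
  \<open>3 * J(x) - J(3 * x) = f'(0) * f(2 * x) ^ 3 / (f(x) ^ 3 * f(3 * x))\<close> (\<open>theta_tripling\<close>).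
  Tripling sends \<open>- w\<close> to \<open>- 3 * w\<close>, which is \<open>2 * w\<close> modulo periods, and it sends \<open>- 2 * w\<close> to
  \<open>- 6 * w\<close>, which is \<open>- w\<close> modulo periods. The identity at these two points is therefore a system
  of two linear equations for the two logarithmic derivatives in question. Its determinant is
  \<open>10\<close> up to sign, and its solution is the theorem. In \<open>theta_char_tripling\<close> the identity is rewritten for
  theta functions with characteristics, so that no exponential factors are left; the root
  of unity in the theorem comes from reducing the characteristic \<open>- 7/5\<close> to \<open>3/5\<close>.

  The tripling identity is the derivative, at a point where one term vanishes, of the three-term
  relation \<open>theta_three_term\<close>. That relation follows by pure algebra from
  \<open>theta_one_one_product\<close>, which expresses \<open>f(x + y) * f(x - y)\<close> as a \<open>2 \<times> 2\<close> determinant of theta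
  functions with parameter \<open>2 * \<tau>\<close>, and which is a rearrangement of an absolutely convergent double series.

  Dividing by the theta constants requires that they do not vanish. That the zeros of \<open>f\<close> lie in
  the lattice spanned by \<open>1\<close> and \<open>\<tau>\<close> (\<open>theta_one_one_zero_in_lattice\<close>) is again a consequence of
  the three-term relation: a zero \<open>u\<close> makes \<open>f(z - u)\<close> and \<open>f(z)\<close> proportional up to an exponential
  \<open>exp (\<mu> * z)\<close>, so \<open>u\<close> behaves like a period of \<open>f\<close>, and this is incompatible with the
  quasi-periods \<open>1\<close> and \<open>\<tau>\<close> unless \<open>u\<close> lies in their lattice.
\<close>

section \<open>Convergence and holomorphy of the theta series\<close>

definition theta_term :: "real \<Rightarrow> real \<Rightarrow> complex \<Rightarrow> complex \<Rightarrow> int \<Rightarrow> complex" where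
  "theta_term \<epsilon> \<epsilon>' \<zeta> \<tau> n =
     exp (2 * of_real pi * \<i> *
          (1 / 2 * (of_int n + of_real \<epsilon> / 2) ^ 2 * \<tau>
           + (of_int n + of_real \<epsilon> / 2) * (\<zeta> + of_real \<epsilon>' / 2)))"

lemma theta_eq_infsum: "theta \<epsilon> \<epsilon>' \<zeta> \<tau> = (\<Sum>\<^sub>\<infinity>n. theta_term \<epsilon> \<epsilon>' \<zeta> \<tau> n)"
  by (simp add: theta_def theta_term_def)

lemma summable_exp_minus_abs_int: "(\<lambda>n::int. exp (- \<bar>real_of_int n\<bar>)) summable_on UNIV"
proof -
  have geometric: "(\<lambda>k::nat. exp (- real k)) summable_on UNIV"
  proof (rule norm_summable_imp_summable_on)
    have "summable (\<lambda>k::nat. exp (- 1 :: real) ^ k)"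
      by (rule summable_geometric) simp
    then show "summable (\<lambda>k::nat. norm (exp (- real k)))"
      by (simp flip: exp_of_nat_mult)
  qed
  have "(\<lambda>n::int. exp (- \<bar>real_of_int n\<bar>)) summable_on range int"
    using geometric by (subst summable_on_reindex) (auto simp: o_def inj_on_def)
  moreover have "(\<lambda>n::int. exp (- \<bar>real_of_int n\<bar>)) summable_on range (\<lambda>k. - int k)"
    using geometric by (subst summable_on_reindex) (auto simp: o_def inj_on_def)
  ultimately have "(\<lambda>n::int. exp (- \<bar>real_of_int n\<bar>)) summable_on range int \<union> range (\<lambda>k. - int k)"
    by (rule summable_on_union)
  also have "range int \<union> range (\<lambda>k. - int k) = UNIV"
    by (auto intro: int_cases2)
  finally show ?thesis .
qed

lemma norm_theta_term:
  "norm (theta_term \<epsilon> \<epsilon>' \<zeta> \<tau> n) =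
     exp (- pi * (of_int n + \<epsilon> / 2)\<^sup>2 * Im \<tau> - 2 * pi * (of_int n + \<epsilon> / 2) * Im \<zeta>)"
proof -
  have "of_int n + of_real \<epsilon> / 2 = (of_real (of_int n + \<epsilon> / 2) :: complex)"
    by simp
  then show ?thesis
    unfolding theta_term_def norm_exp_eq_Re
    by (simp only: power2_eq_square) (simp add: algebra_simps)
qed

lemma quadratic_lower_bound:
  fixes a b x :: real
  assumes "a > 0"
  shows "b * x - a * x\<^sup>2 \<le> b\<^sup>2 / (4 * a)"
proof -
  have "0 \<le> (2 * a * x - b)\<^sup>2"
    by (rule zero_le_power2)
  then have "(b * x - a * x\<^sup>2) * (4 * a) \<le> b\<^sup>2"
    by (simp add: power2_eq_square algebra_simps)
  then show ?thesis
    using assms by (subst pos_le_divide_eq) simp_all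
qed

text \<open>
  On a horizontal strip the Gaussian factor beats the exponential one. The bound is independent of
  \<open>\<zeta>\<close> and summable in \<open>n\<close>, which gives uniform convergence there.
\<close>

lemma theta_term_dominated:
  assumes "Im \<tau> > 0" "\<bar>Im \<zeta>\<bar> \<le> B"
  shows "norm (theta_term \<epsilon> \<epsilon>' \<zeta> \<tau> n) \<le>
           exp ((2 * pi * B + 1)\<^sup>2 / (4 * pi * Im \<tau>) + \<bar>\<epsilon> / 2\<bar>) * exp (- \<bar>real_of_int n\<bar>)"
proof -
  define x where "x = \<bar>of_int n + \<epsilon> / 2\<bar>"
  define a where "a = pi * Im \<tau>"
  define b where "b = 2 * pi * B + 1"
  have a: "a > 0"
    unfolding a_def using assms(1) pi_gt_zero by (rule mult_pos_pos[rotated])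
  have "- ((of_int n + \<epsilon> / 2) * Im \<zeta>) \<le> \<bar>(of_int n + \<epsilon> / 2) * Im \<zeta>\<bar>"
    by (rule abs_ge_minus_self)
  also have "\<dots> \<le> x * B"
    unfolding abs_mult x_def by (rule mult_left_mono[OF assms(2) abs_ge_zero])
  finally have "2 * pi * (- ((of_int n + \<epsilon> / 2) * Im \<zeta>)) \<le> 2 * pi * (x * B)"
    by (rule mult_left_mono) (use pi_gt_zero in linarith)
  moreover have "x \<ge> \<bar>real_of_int n\<bar> - \<bar>\<epsilon> / 2\<bar>"
    unfolding x_def by linarith
  moreover have "pi * (of_int n + \<epsilon> / 2)\<^sup>2 * Im \<tau> = a * x\<^sup>2"
    unfolding a_def x_def power2_abs by (simp only: mult_ac)
  moreover have "b * x = 2 * pi * (x * B) + x"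
    unfolding b_def by (simp only: ring_distribs mult_ac mult_1)
  moreover note quadratic_lower_bound[OF a, of b x]
  ultimately have "- pi * (of_int n + \<epsilon> / 2)\<^sup>2 * Im \<tau> - 2 * pi * (of_int n + \<epsilon> / 2) * Im \<zeta>
      \<le> (b\<^sup>2 / (4 * a) + \<bar>\<epsilon> / 2\<bar>) + - \<bar>real_of_int n\<bar>"
    by (simp only: mult.assoc mult_minus_left mult_minus_right)
  then show ?thesis
    unfolding norm_theta_term exp_add[symmetric] exp_le_cancel_iff a_def b_def
    by (simp only: mult.assoc)
qed

lemma uniform_limit_theta:
  assumes "Im \<tau> > 0"
  shows "uniform_limit {\<zeta>. \<bar>Im \<zeta>\<bar> \<le> B} (\<lambda>N \<zeta>. \<Sum>n\<in>N. theta_term \<epsilon> \<epsilon>' \<zeta> \<tau> n)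
           (\<lambda>\<zeta>. theta \<epsilon> \<epsilon>' \<zeta> \<tau>) (finite_subsets_at_top UNIV)"
  unfolding theta_eq_infsum
  by (rule Weierstrass_m_test_general[where M = "\<lambda>n. _ * exp (- \<bar>real_of_int n\<bar>)"])
     (use assms in \<open>auto intro!: theta_term_dominated summable_on_cmult_right
        summable_exp_minus_abs_int\<close>)

lemma theta_term_abs_summable:
  assumes "Im \<tau> > 0"
  shows "(\<lambda>n. norm (theta_term \<epsilon> \<epsilon>' \<zeta> \<tau> n)) summable_on A"
proof (rule Infinite_Sum.abs_summable_on_comparison_test')
  show "(\<lambda>n. exp ((2 * pi * \<bar>Im \<zeta>\<bar> + 1)\<^sup>2 / (4 * pi * Im \<tau>) + \<bar>\<epsilon> / 2\<bar>) *
          exp (- \<bar>real_of_int n\<bar>)) summable_on A"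
    by (intro summable_on_cmult_right summable_on_subset_banach[OF summable_exp_minus_abs_int]) auto
qed (use assms theta_term_dominated in auto)

lemma theta_holomorphic:
  assumes "Im \<tau> > 0"
  shows "(\<lambda>\<zeta>. theta \<epsilon> \<epsilon>' \<zeta> \<tau>) holomorphic_on UNIV"
proof -
  have "(\<lambda>\<zeta>. theta \<epsilon> \<epsilon>' \<zeta> \<tau>) field_differentiable at z" for z
  proof -
    have "\<bar>Im w\<bar> \<le> \<bar>Im z\<bar> + 1" if "w \<in> cball z 1" for w
      using abs_Im_le_cmod[of "w - z"] that by (auto simp: dist_norm norm_minus_commute)
    then have "uniform_limit (cball z 1) (\<lambda>N \<zeta>. \<Sum>n\<in>N. theta_term \<epsilon> \<epsilon>' \<zeta> \<tau> n)
           (\<lambda>\<zeta>. theta \<epsilon> \<epsilon>' \<zeta> \<tau>) (finite_subsets_at_top UNIV)"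
      by (intro uniform_limit_on_subset[OF uniform_limit_theta[OF assms]]) auto
    then have "(\<lambda>\<zeta>. theta \<epsilon> \<epsilon>' \<zeta> \<tau>) holomorphic_on ball z 1"
      by (rule holomorphic_uniform_limit[rotated])
         (auto intro!: always_eventually holomorphic_intros continuous_intros
               simp: theta_term_def)
    then show ?thesis
      by (simp add: holomorphic_on_imp_differentiable_at)
  qed
  then show ?thesis
    by (simp add: holomorphic_on_def field_differentiable_at_within)
qed

lemma theta_has_field_derivative:
  assumes "Im \<tau> > 0"
  shows "((\<lambda>\<zeta>. theta \<epsilon> \<epsilon>' \<zeta> \<tau>) has_field_derivative deriv (\<lambda>\<zeta>. theta \<epsilon> \<epsilon>' \<zeta> \<tau>) z) (at z)"
  using holomorphic_derivI[OF theta_holomorphic[OF assms] open_UNIV UNIV_I] .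

section \<open>Changing the characteristics\<close>

lemma theta_uminus_char: "theta (- \<epsilon>) (- \<epsilon>') \<zeta> \<tau> = theta \<epsilon> \<epsilon>' (- \<zeta>) \<tau>"
proof -
  have "theta_term (- \<epsilon>) (- \<epsilon>') \<zeta> \<tau> (- n) = theta_term \<epsilon> \<epsilon>' (- \<zeta>) \<tau> n" for n
  proof -
    have "of_int (- n) + of_real (- \<epsilon>) / 2 = (- (of_int n + of_real \<epsilon> / 2) :: complex)"
         "\<zeta> + of_real (- \<epsilon>') / 2 = - (- \<zeta> + of_real \<epsilon>' / 2)"
      by simp_all
    then show ?thesis
      unfolding theta_term_def by (simp only: power2_minus minus_mult_minus)
  qed
  then show ?thesis
    unfolding theta_eq_infsum
    using infsum_reindex_bij_betw[OF bij_uminus, of "theta_term (- \<epsilon>) (- \<epsilon>') \<zeta> \<tau>"] by simp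
qed

lemma theta_char_add_two: "theta (\<epsilon> + 2) \<epsilon>' \<zeta> \<tau> = theta \<epsilon> \<epsilon>' \<zeta> \<tau>"
proof -
  have "theta_term \<epsilon> \<epsilon>' \<zeta> \<tau> (n + 1) = theta_term (\<epsilon> + 2) \<epsilon>' \<zeta> \<tau> n" for n
    unfolding theta_term_def by (rule arg_cong[of _ _ exp]) (simp add: ring_distribs add_divide_distrib add_ac)
  moreover have "bij (\<lambda>n::int. n + 1)"
    by (rule bij_plus_right)
  ultimately show ?thesis
    unfolding theta_eq_infsum
    using infsum_reindex_bij_betw[of "\<lambda>n. n + 1" UNIV UNIV "theta_term \<epsilon> \<epsilon>' \<zeta> \<tau>"] by simp
qed

text \<open>
  A change of characteristics is a translation of the argument, up to a nowhere vanishing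
  exponential factor: shift \<open>n + \<epsilon> / 2\<close> by \<open>\<alpha> / 2\<close> in each exponent and expand the square.
\<close>

lemma theta_char_add:
  "theta (\<epsilon> + \<alpha>) (\<epsilon>' + \<beta>) \<zeta> \<tau> =
     exp (2 * of_real pi * \<i> * (of_real \<alpha> ^ 2 * \<tau> / 8 + of_real \<alpha> / 2 * (\<zeta> + of_real (\<epsilon>' + \<beta>) / 2))) *
     theta \<epsilon> \<epsilon>' (\<zeta> + (of_real \<alpha> * \<tau> + of_real \<beta>) / 2) \<tau>"
  unfolding theta_eq_infsum infsum_cmult_right'[symmetric]
proof (rule infsum_cong)
  fix n :: int
  show "theta_term (\<epsilon> + \<alpha>) (\<epsilon>' + \<beta>) \<zeta> \<tau> n =
      exp (2 * of_real pi * \<i> * (of_real \<alpha> ^ 2 * \<tau> / 8 + of_real \<alpha> / 2 * (\<zeta> + of_real (\<epsilon>' + \<beta>) / 2))) *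
      theta_term \<epsilon> \<epsilon>' (\<zeta> + (of_real \<alpha> * \<tau> + of_real \<beta>) / 2) \<tau> n"
    unfolding theta_term_def exp_add[symmetric]
    by (rule arg_cong[of _ _ exp]) (simp add: power2_eq_square ring_distribs add_divide_distrib)
qed

lemma theta_char_add_two': 
  "theta \<epsilon> (\<epsilon>' + 2) \<zeta> \<tau> = exp (of_real (pi * \<epsilon>) * \<i>) * theta \<epsilon> \<epsilon>' \<zeta> \<tau>"
  unfolding theta_eq_infsum infsum_cmult_right'[symmetric]
proof (rule infsum_cong)
  fix n :: int
  have "theta_term \<epsilon> (\<epsilon>' + 2) \<zeta> \<tau> n =
      exp (2 * of_int n * of_real pi * \<i>) * (exp (of_real (pi * \<epsilon>) * \<i>) * theta_term \<epsilon> \<epsilon>' \<zeta> \<tau> n)"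
    unfolding theta_term_def exp_add[symmetric]
    by (rule arg_cong[of _ _ exp]) (simp add: ring_distribs add_divide_distrib)
  moreover have "exp (2 * of_int n * of_real pi * \<i>) = 1"
    using exp_integer_2pi[of "of_int n"] by simp
  ultimately show "theta_term \<epsilon> (\<epsilon>' + 2) \<zeta> \<tau> n = exp (of_real (pi * \<epsilon>) * \<i>) * theta_term \<epsilon> \<epsilon>' \<zeta> \<tau> n"
    by simp
qed

section \<open>The product formula and its consequences\<close>

lemma infsum_mult_abs:
  fixes a b :: "'a \<Rightarrow> complex"
  assumes a: "(\<lambda>m. norm (a m)) summable_on UNIV" and b: "(\<lambda>n. norm (b n)) summable_on UNIV"
  shows "(\<lambda>(m, n). a m * b n) summable_on UNIV"
    and "(\<Sum>\<^sub>\<infinity>(m, n). a m * b n) = (\<Sum>\<^sub>\<infinity>m. a m) * (\<Sum>\<^sub>\<infinity>n. b n)"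
proof -
  have "(\<lambda>p. norm (case p of (m, n) \<Rightarrow> a m * b n)) summable_on Sigma UNIV (\<lambda>_. UNIV)"
  proof (rule summable_on_SigmaI)
    show "((\<lambda>n. norm (case (m, n) of (m, n) \<Rightarrow> a m * b n)) has_sum
            norm (a m) * (\<Sum>\<^sub>\<infinity>n. norm (b n))) UNIV" for m
      unfolding prod.case norm_mult using b by (intro has_sum_cmult_right has_sum_infsum)
    show "(\<lambda>m. norm (a m) * (\<Sum>\<^sub>\<infinity>n. norm (b n))) summable_on UNIV"
      using a by (rule summable_on_cmult_left)
  qed simp
  then show summable: "(\<lambda>(m, n). a m * b n) summable_on UNIV"
    using abs_summable_summable by fastforce
  show "(\<Sum>\<^sub>\<infinity>(m, n). a m * b n) = (\<Sum>\<^sub>\<infinity>m. a m) * (\<Sum>\<^sub>\<infinity>n. b n)"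
    using infsum_Sigma_banach[of "\<lambda>(m, n). a m * b n" UNIV "\<lambda>_. UNIV"] summable
    by (simp add: infsum_cmult_right' infsum_cmult_left')
qed

text \<open>
  Multiply the two series and pass from the summation indices \<open>(m, n)\<close> to
  \<open>s = m + n + 1\<close> and \<open>d = m - n\<close>. Since \<open>(m + 1/2)\<^sup>2 + (n + 1/2)\<^sup>2 = (s\<^sup>2 + d\<^sup>2) / 2\<close>, this
  separates the variables \<open>x\<close> and \<open>y\<close>. The only constraint on \<open>s\<close> and \<open>d\<close> is that their
  parities differ, and the sign of a term is that of \<open>(-1) ^ s\<close>; this gives the two products.
\<close>

lemma theta_one_one_product:
  assumes "Im \<tau> > 0"
  shows "theta 1 1 (x + y) \<tau> * theta 1 1 (x - y) \<tau> =
           theta 0 0 (2 * x) (2 * \<tau>) * theta 1 0 (2 * y) (2 * \<tau>) -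
           theta 1 0 (2 * x) (2 * \<tau>) * theta 0 0 (2 * y) (2 * \<tau>)"
proof -
  define t where "t = (\<lambda>(m, n). theta_term 1 1 (x + y) \<tau> m * theta_term 1 1 (x - y) \<tau> n)"
  define h where "h = (\<lambda>(j, k). (j + k, j - k - 1) :: int \<times> int)"
  define h' where "h' = (\<lambda>(j, k). (j + k, j - k) :: int \<times> int)"
  have t_h: "t (h p) = (case p of (j, k) \<Rightarrow>
      theta_term 0 0 (2 * x) (2 * \<tau>) j * theta_term 1 0 (2 * y) (2 * \<tau>) k)" for p
  proof -
    obtain j k where p: "p = (j, k)" by (cases p)
    have "t (h p) = exp (2 * of_int j * of_real pi * \<i>) *
        (theta_term 0 0 (2 * x) (2 * \<tau>) j * theta_term 1 0 (2 * y) (2 * \<tau>) k)"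
      unfolding p t_def h_def prod.case theta_term_def exp_add[symmetric]
      by (rule arg_cong[of _ _ exp]) (simp add: power2_eq_square ring_distribs add_divide_distrib diff_divide_distrib)
    moreover have "exp (2 * of_int j * of_real pi * \<i>) = 1"
      using exp_integer_2pi[of "of_int j"] by simp
    ultimately show ?thesis by (simp add: p)
  qed
  have t_h': "t (h' p) = - (case p of (j, k) \<Rightarrow>
      theta_term 1 0 (2 * x) (2 * \<tau>) j * theta_term 0 0 (2 * y) (2 * \<tau>) k)" for p
  proof -
    obtain j k where p: "p = (j, k)" by (cases p)
    have "t (h' p) = exp (2 * of_int j * of_real pi * \<i>) * exp (of_real pi * \<i>) *
        (theta_term 1 0 (2 * x) (2 * \<tau>) j * theta_term 0 0 (2 * y) (2 * \<tau>) k)"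
      unfolding p t_def h'_def prod.case theta_term_def exp_add[symmetric]
      by (rule arg_cong[of _ _ exp]) (simp add: power2_eq_square ring_distribs add_divide_distrib diff_divide_distrib)
    moreover have "exp (2 * of_int j * of_real pi * \<i>) = 1"
      using exp_integer_2pi[of "of_int j"] by simp
    ultimately show ?thesis by (simp add: p)
  qed
  have inj: "inj h" "inj h'"
    by (auto simp: h_def h'_def inj_on_def)
  have disjoint: "range h \<inter> range h' = {}"
  proof -
    have False if "h p = h' q" for p q
      using that by (cases p; cases q) (simp add: h_def h'_def, presburger)
    then show ?thesis by blast
  qed
  have cover: "range h \<union> range h' = UNIV"
  proof -
    have "(m, n) \<in> range h \<union> range h'" for m n
    proof (cases "even (m + n)")
      case True
      then obtain j where "m + n = 2 * j" by (rule evenE)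
      then have "(m, n) = h' (j, m - j)" by (simp add: h'_def)
      then show ?thesis by blast
    next
      case False
      then obtain j where "m + n = 2 * j + 1" by (rule oddE)
      then have "(m, n) = h (j + 1, m - j - 1)" by (simp add: h_def)
      then show ?thesis by blast
    qed
    then show ?thesis by auto
  qed
  have summable: "(\<lambda>n. norm (theta_term \<epsilon> \<epsilon>' z \<tau> n)) summable_on UNIV"
    "(\<lambda>n. norm (theta_term \<epsilon> \<epsilon>' z (2 * \<tau>) n)) summable_on UNIV" for \<epsilon> \<epsilon>' z
    using assms by (intro theta_term_abs_summable; simp)+
  have t: "t summable_on UNIV"
    unfolding t_def by (intro infsum_mult_abs summable)
  have "theta 1 1 (x + y) \<tau> * theta 1 1 (x - y) \<tau> = infsum t UNIV"
    unfolding theta_eq_infsum t_def by (intro infsum_mult_abs(2)[symmetric] summable)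
  also have "\<dots> = infsum t (range h) + infsum t (range h')"
    using infsum_Un_disjoint[OF _ _ disjoint, of t] summable_on_subset_banach[OF t]
    by (simp add: cover)
  also have "infsum t (range h) = theta 0 0 (2 * x) (2 * \<tau>) * theta 1 0 (2 * y) (2 * \<tau>)"
    unfolding infsum_reindex[OF inj(1)] o_def t_h theta_eq_infsum
    by (intro infsum_mult_abs(2) summable)
  also have "infsum t (range h') = - (theta 1 0 (2 * x) (2 * \<tau>) * theta 0 0 (2 * y) (2 * \<tau>))"
    unfolding infsum_reindex[OF inj(2)] o_def t_h' infsum_uminus theta_eq_infsum
    by (intro arg_cong[of _ _ uminus] infsum_mult_abs(2) summable)
  finally show ?thesis by simp
qed

text \<open>
  The left hand side of the product formula is, as a function of \<open>x\<close> and \<open>y\<close>, a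
  \<open>2 \<times> 2\<close> determinant of values of two fixed functions, so this is the Pluecker relation
  between the six minors of a \<open>2 \<times> 4\<close> matrix.
\<close>

lemma theta_three_term:
  assumes "Im \<tau> > 0"
  defines "f \<equiv> \<lambda>z. theta 1 1 z \<tau>"
  shows "f (a + b) * f (a - b) * f (c + d) * f (c - d) +
         f (b + c) * f (b - c) * f (a + d) * f (a - d) +
         f (c + a) * f (c - a) * f (b + d) * f (b - d) = 0"
proof -
  have "(f (a + b) * f (a - b)) * (f (c + d) * f (c - d)) +
        (f (b + c) * f (b - c)) * (f (a + d) * f (a - d)) +
        (f (c + a) * f (c - a)) * (f (b + d) * f (b - d)) = 0"
    unfolding f_def theta_one_one_product[OF assms(1)] by algebra
  then show ?thesis by (simp only: mult.assoc)
qed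

lemma theta_one_one_uminus: "theta 1 1 (- z) \<tau> = - theta 1 1 z \<tau>"
  using theta_uminus_char[of 1 1 z \<tau>] theta_char_add_two[of "- 1" "- 1" z \<tau>]
    theta_char_add_two'[of 1 "- 1" z \<tau>]
  by simp

lemma deriv_theta_one_one_uminus:
  assumes "Im \<tau> > 0"
  shows "deriv (\<lambda>z. theta 1 1 z \<tau>) (- z) = deriv (\<lambda>z. theta 1 1 z \<tau>) z"
proof -
  have "((\<lambda>z. - theta 1 1 (- z) \<tau>) has_field_derivative deriv (\<lambda>z. theta 1 1 z \<tau>) (- z)) (at z)"
    by (auto intro!: derivative_eq_intros DERIV_chain2[OF theta_has_field_derivative[OF assms]])
  then show ?thesis
    by (simp add: theta_one_one_uminus DERIV_imp_deriv)
qed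

text \<open>
  In logarithmic form: \<open>3 J(x) - J(3 x) = f'(0) f(2 x) ^ 3 / (f(x) ^ 3 f(3 x))\<close> for
  \<open>J = f' / f\<close>. It arises by choosing \<open>(a, b, c, d) = (2 x, 0, c, x)\<close> in the three-term
  relation, where one term vanishes at \<open>c = x\<close>, and comparing derivatives in \<open>c\<close> there.
\<close>

lemma theta_tripling:
  assumes "Im \<tau> > 0"
  defines "f \<equiv> \<lambda>z. theta 1 1 z \<tau>"
  shows "f (2 * x) ^ 3 * deriv f 0 =
           3 * f x ^ 2 * deriv f x * f (3 * x) - f x ^ 3 * deriv f (3 * x)"
proof -
  note D = theta_has_field_derivative[OF assms(1), of 1 1, folded f_def]
  have odd: "f (- z) = - f z" for z
    by (simp add: f_def theta_one_one_uminus)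
  have even: "deriv f (- z) = deriv f z" for z
    using deriv_theta_one_one_uminus[OF assms(1)] by (simp add: f_def)
  have relation: "f (2 * x) ^ 2 * (f (c + x) * f (c - x)) =
      f c ^ 2 * f (3 * x) * f x + f (c + 2 * x) * f (c - 2 * x) * f x ^ 2" for c
  proof -
    have "f (2 * x + 0) * f (2 * x - 0) * f (c + x) * f (c - x) +
        f (0 + c) * f (0 - c) * f (2 * x + x) * f (2 * x - x) +
        f (c + 2 * x) * f (c - 2 * x) * f (0 + x) * f (0 - x) = 0"
      unfolding f_def by (rule theta_three_term[OF assms(1)])
    moreover have "2 * x + x = 3 * x" "2 * x - x = x" by simp_all
    ultimately show ?thesis
      by (simp add: odd power2_eq_square mult_ac add_ac diff_eq_eq)
  qed
  have "((\<lambda>c. f (2 * x) ^ 2 * (f (c + x) * f (c - x))) has_field_derivative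
      f (2 * x) ^ 2 * (deriv f (x + x) * f (x - x) + deriv f (x - x) * f (x + x))) (at x)"
    by (auto intro!: derivative_eq_intros DERIV_chain2[OF D] simp: algebra_simps)
  moreover have "((\<lambda>c. f c ^ 2 * f (3 * x) * f x + f (c + 2 * x) * f (c - 2 * x) * f x ^ 2)
      has_field_derivative 2 * f x * deriv f x * f (3 * x) * f x +
        (deriv f (x + 2 * x) * f (x - 2 * x) + deriv f (x - 2 * x) * f (x + 2 * x)) * f x ^ 2)
      (at x)"
    by (auto intro!: derivative_eq_intros DERIV_chain2[OF D] D simp: algebra_simps)
  ultimately have "f (2 * x) ^ 2 * (deriv f (x + x) * f (x - x) + deriv f (x - x) * f (x + x)) =
      2 * f x * deriv f x * f (3 * x) * f x +
        (deriv f (x + 2 * x) * f (x - 2 * x) + deriv f (x - 2 * x) * f (x + 2 * x)) * f x ^ 2"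
    unfolding relation by (rule DERIV_unique)
  moreover have "x + x = 2 * x" "x - x = 0" "x + 2 * x = 3 * x" "x - 2 * x = - x" "f 0 = 0"
    using odd[of 0] by simp_all
  ultimately show ?thesis
    unfolding odd even by (simp only: odd even) algebra
qed

section \<open>The zeros of the odd theta function\<close>

text \<open>
  The zeroth Fourier coefficient of \<open>theta 0 0\<close> is \<open>1\<close>, so \<open>theta 0 0\<close> and its translate
  \<open>theta 1 1\<close> are not the zero function.
\<close>

lemma theta_one_one_not_identically_zero:
  assumes "Im \<tau> > 0"
  shows "\<exists>z. theta 1 1 z \<tau> \<noteq> 0"
proof (rule ccontr)
  assume "\<not> ?thesis"
  then have zero: "theta 0 0 z \<tau> = 0" for z
    using theta_char_add[of 1 "- 1" 1 "- 1" z \<tau>] by simp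
  have integral: "((\<lambda>x. theta_term 0 0 (of_real x) \<tau> n) has_integral (if n = 0 then 1 else 0)) {0..1}" for n
  proof (cases "n = 0")
    case True
    then show ?thesis
      using has_integral_const_real[of "1 :: complex" 0 1] by (simp add: theta_term_def)
  next
    case False
    define k where "k = 2 * of_real pi * \<i> * of_int n"
    define c where "c = exp (2 * of_real pi * \<i> * (1 / 2 * of_int n ^ 2 * \<tau>))"
    have "k \<noteq> 0" using False by (simp add: k_def)
    have "theta_term 0 0 (of_real x) \<tau> n = c * exp (k * of_real x)" for x
      unfolding theta_term_def c_def k_def exp_add[symmetric]
      by (rule arg_cong[of _ _ exp]) (simp add: ring_distribs)
    moreover have "((\<lambda>x. c * exp (k * of_real x)) has_integral
        c * exp (k * of_real 1) / k - c * exp (k * of_real 0) / k) {0..1}"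
    proof (rule fundamental_theorem_of_calculus)
      fix x :: real
      have "((\<lambda>z. c * exp (k * z) / k) has_field_derivative c * exp (k * of_real x)) (at (of_real x))"
        using \<open>k \<noteq> 0\<close> by (auto intro!: derivative_eq_intros)
      then show "((\<lambda>x. c * exp (k * of_real x) / k) has_vector_derivative c * exp (k * of_real x))
          (at x within {0..1})"
        by (rule has_vector_derivative_real_field)
    qed simp
    moreover have "exp k = 1"
      using exp_integer_2pi[of "of_int n"] by (simp add: k_def mult_ac)
    ultimately show ?thesis using False by simp
  qed
  have "uniform_limit {0..1 :: real} (\<lambda>N x. \<Sum>n\<in>N. theta_term 0 0 (of_real x) \<tau> n)
          (\<lambda>x. theta 0 0 (of_real x) \<tau>) (finite_subsets_at_top UNIV)"
    by (rule uniform_limit_compose'[OF uniform_limit_theta[OF assms, of 0]]) auto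
  moreover have "continuous_on {0..1} (\<lambda>x. \<Sum>n\<in>N. theta_term 0 0 (of_real x) \<tau> n)" for N
    unfolding theta_term_def by (intro continuous_intros)
  ultimately obtain I J
    where I: "\<And>N. ((\<lambda>x. \<Sum>n\<in>N. theta_term 0 0 (of_real x) \<tau> n) has_integral I N) {0..1}"
    and J: "((\<lambda>x. theta 0 0 (of_real x) \<tau>) has_integral J) {0..1}"
    and lim: "(I \<longlongrightarrow> J) (finite_subsets_at_top UNIV)"
    using uniform_limit_integral[OF _ _ finite_subsets_at_top_neq_bot] by metis
  have "I N = 1" if "finite N" "{0} \<subseteq> N" for N
  proof -
    have "((\<lambda>x. \<Sum>n\<in>N. theta_term 0 0 (of_real x) \<tau> n) has_integral (\<Sum>n\<in>N. if n = 0 then 1 else 0)) {0..1}"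
      using that integral by (intro has_integral_sum)
    then have "I N = (\<Sum>n\<in>N. if n = 0 then 1 else 0)"
      using I has_integral_unique by blast
    then show ?thesis using that by simp
  qed
  then have "eventually (\<lambda>N. I N = 1) (finite_subsets_at_top UNIV)"
    unfolding eventually_finite_subsets_at_top by (intro exI[of _ "{0}"]) auto
  from tendsto_cong[OF this] lim have "((\<lambda>_. 1) \<longlongrightarrow> J) (finite_subsets_at_top (UNIV :: int set))"
    by (rule iffD1)
  then have "J = 1"
    by (rule tendsto_unique[OF finite_subsets_at_top_neq_bot _ tendsto_const])
  moreover have "J = 0"
    using J unfolding zero by (rule has_integral_unique[OF _ has_integral_0])
  ultimately show False by simp
qed

text \<open>
  Differentiating the functional equation in \<open>x\<close> and in \<open>y\<close> gives the same right hand side,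
  so \<open>\<rho>'(x) * \<rho>(y)\<close> is symmetric and \<open>\<rho>' / \<rho>\<close> is constant.
\<close>

lemma midpoint_multiplicative_imp_exponential:
  fixes \<rho> :: "complex \<Rightarrow> complex"
  assumes "open S" "convex S" "\<rho> holomorphic_on S" "\<And>x. x \<in> S \<Longrightarrow> \<rho> x \<noteq> 0"
    and mid: "\<And>x y. x \<in> S \<Longrightarrow> y \<in> S \<Longrightarrow> \<rho> x * \<rho> y = \<rho> ((x + y) / 2) ^ 2"
  obtains K \<mu> where "\<And>x. x \<in> S \<Longrightarrow> \<rho> x = K * exp (\<mu> * x)"
proof (cases "S = {}")
  case False
  then obtain p where p: "p \<in> S" by blast
  have D: "(\<rho> has_field_derivative deriv \<rho> x) (at x)" if "x \<in> S" for x
    using assms that by (auto intro: holomorphic_derivI)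
  have deriv_mid: "deriv \<rho> x * \<rho> y = \<rho> ((x + y) / 2) * deriv \<rho> ((x + y) / 2)"
    if x: "x \<in> S" and y: "y \<in> S" for x y
  proof -
    have m: "(x + y) / 2 \<in> S"
      using convexD[OF \<open>convex S\<close> x y, of "1 / 2" "1 / 2"] by (simp add: scaleR_conv_of_real add_divide_distrib)
    have "((\<lambda>x. (x + y) / 2) has_field_derivative 1 / 2) (at x)"
      by (auto intro!: derivative_eq_intros)
    then have "((\<lambda>x. \<rho> ((x + y) / 2)) has_field_derivative deriv \<rho> ((x + y) / 2) * (1 / 2)) (at x)"
      by (rule DERIV_chain2[of \<rho>, rotated]) (rule D[OF m])
    from DERIV_power[OF this, of 2]
    have "((\<lambda>x. \<rho> ((x + y) / 2) ^ 2) has_field_derivative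
        \<rho> ((x + y) / 2) * deriv \<rho> ((x + y) / 2)) (at x)"
      by (simp add: mult_ac)
    moreover have "((\<lambda>x. \<rho> x * \<rho> y) has_field_derivative deriv \<rho> x * \<rho> y) (at x)"
      by (auto intro!: derivative_eq_intros D[OF x])
    then have "((\<lambda>x. \<rho> ((x + y) / 2) ^ 2) has_field_derivative deriv \<rho> x * \<rho> y) (at x)"
      by (rule has_field_derivative_transform_within_open[OF _ \<open>open S\<close> x]) (use y mid in auto)
    ultimately show ?thesis by (blast intro: DERIV_unique)
  qed
  define \<mu> where "\<mu> = deriv \<rho> p / \<rho> p"
  have log_deriv: "deriv \<rho> x = \<mu> * \<rho> x" if "x \<in> S" for x
  proof -
    have "deriv \<rho> x * \<rho> p = deriv \<rho> p * \<rho> x"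
      using deriv_mid[OF that p] deriv_mid[OF p that] by (simp only: add.commute)
    then show ?thesis
      using assms(4)[OF p] by (simp add: \<mu>_def nonzero_eq_divide_eq)
  qed
  have "((\<lambda>x. \<rho> x * exp (- (\<mu> * x))) has_field_derivative 0) (at x within S)" if x: "x \<in> S" for x
  proof -
    have "((\<lambda>x. exp (- (\<mu> * x))) has_field_derivative - \<mu> * exp (- (\<mu> * x))) (at x)"
      by (auto intro!: derivative_eq_intros)
    from DERIV_mult[OF D[OF x] this]
    have "((\<lambda>x. \<rho> x * exp (- (\<mu> * x))) has_field_derivative 0) (at x)"
      unfolding log_deriv[OF x] by (simp add: mult_ac)
    then show ?thesis by (rule has_field_derivative_at_within)
  qed
  from has_field_derivative_zero_constant[OF \<open>convex S\<close> this]
  obtain K where K: "\<And>x. x \<in> S \<Longrightarrow> \<rho> x * exp (- (\<mu> * x)) = K"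
    by metis
  have "\<rho> x = K * exp (\<mu> * x)" if "x \<in> S" for x
    unfolding K[OF that, symmetric] mult.assoc exp_add[symmetric] by simp
  then show ?thesis by (rule that)
next
  case True
  then show ?thesis using that[of 0 0] by simp
qed

lemma theta_one_one_add_one: "theta 1 1 (z + 1) \<tau> = - theta 1 1 z \<tau>"
  using theta_char_add[of 1 0 1 2 z \<tau>] theta_char_add_two'[of 1 1 z \<tau>] by simp

lemma theta_one_one_add_tau:
  "theta 1 1 z \<tau> = exp (2 * of_real pi * \<i> * (\<tau> / 2 + z + 1 / 2)) * theta 1 1 (z + \<tau>) \<tau>"
  using theta_char_add[of 1 2 1 0 z \<tau>] theta_char_add_two[of 1 1 z \<tau>] by (simp add: add.assoc)

text \<open>
  If \<open>u\<close> is a zero of \<open>f = theta 1 1\<close> then a summand of the three-term relation drops out, and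
  what remains says that the quotient of \<open>f (z - u)\<close> by \<open>f z\<close> is multiplicative with respect to
  midpoints. Hence \<open>f (z - u) = K * exp (\<mu> * z) * f z\<close>, first locally, then everywhere.
  Consistency with \<open>f (z + 1) = - f z\<close> forces \<open>\<mu>\<close> to be an integer multiple of \<open>2 * pi * \<i>\<close>,
  and consistency with the quasi-period \<open>\<tau>\<close> then puts \<open>u\<close> into the period lattice.
\<close>

lemma theta_one_one_zero_in_lattice:
  assumes "Im \<tau> > 0" "theta 1 1 u \<tau> = 0"
  obtains m n :: int where "u = of_int m + of_int n * \<tau>"
proof -
  define f where "f = (\<lambda>z. theta 1 1 z \<tau>)"
  define F where "F = (\<lambda>z. f (z - u))"
  have hol: "f holomorphic_on S" for S
    using theta_holomorphic[OF assms(1)] unfolding f_def by (rule holomorphic_on_subset) simp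
  have hol': "F holomorphic_on S" for S
  proof -
    have "(\<lambda>z. z - u) holomorphic_on S"
      by (intro holomorphic_intros)
    from holomorphic_on_compose[OF this hol] show ?thesis
      by (simp only: F_def o_def)
  qed
  have cont: "continuous_on S f" "continuous_on S F" for S
    by (rule holomorphic_on_imp_continuous_on[OF hol], rule holomorphic_on_imp_continuous_on[OF hol'])
  have odd: "f (- z) = - f z" for z
    by (simp add: f_def theta_one_one_uminus)
  obtain z0 where z0: "f z0 \<noteq> 0"
    using theta_one_one_not_identically_zero[OF assms(1)] unfolding f_def by blast
  \<comment> \<open>The quotient of \<open>F\<close> by \<open>f\<close> has to be defined and nonzero near \<open>p\<close>.\<close>
  obtain p where p: "f p \<noteq> 0" "F p \<noteq> 0"
  proof (rule ccontr)
    assume "\<not> thesis"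
    then have *: "f z \<noteq> 0 \<Longrightarrow> F z = 0" for z using that by blast
    have "open {z. f z \<noteq> 0}"
      using open_Collect_neq[OF cont(1) continuous_on_const] .
    then have "F (z0 + u) = 0"
      by (rule analytic_continuation_open[OF _ open_UNIV _ connected_UNIV subset_UNIV hol' holomorphic_on_const])
         (use z0 * in auto)
    then show False using z0 by (simp add: F_def)
  qed
  have "open {z. f z \<noteq> 0 \<and> F z \<noteq> 0}"
    using cont by (intro open_Collect_conj open_Collect_neq continuous_on_const)
  then obtain r where r: "r > 0" "ball p r \<subseteq> {z. f z \<noteq> 0 \<and> F z \<noteq> 0}"
    using p by (auto simp: open_contains_ball)
  have mid: "F x * F y * f ((x + y) / 2) ^ 2 = F ((x + y) / 2) ^ 2 * (f x * f y)" for x y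
  proof -
    define s a where "s = (x + y) / 2" and "a = (x - y) / 2"
    have xy: "x = s + a" "y = s - a"
      by (simp_all add: s_def a_def field_simps)
    \<comment> \<open>The arguments \<open>s\<close> and \<open>s - u\<close> differ by the zero \<open>u\<close>, so the first summand vanishes.\<close>
    have "f (a + 0) * f (a - 0) * f (s + (s - u)) * f (s - (s - u)) +
        f (0 + s) * f (0 - s) * f (a + (s - u)) * f (a - (s - u)) +
        f (s + a) * f (s - a) * f (0 + (s - u)) * f (0 - (s - u)) = 0"
      unfolding f_def by (rule theta_three_term[OF assms(1)])
    moreover have "f (s - (s - u)) = 0" using assms(2) by (simp add: f_def)
    moreover have "f (a - (s - u)) = - F (s - a)" "f (a + (s - u)) = F (s + a)"
      "f (0 - s) = - f s" "f (0 - (s - u)) = - F s" "f (0 + (s - u)) = F s"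
      using odd[of "s - a - u"] odd[of s] odd[of "s - u"] by (simp_all add: F_def algebra_simps)
    ultimately have "F (s + a) * F (s - a) * f s ^ 2 = F s ^ 2 * (f (s + a) * f (s - a))"
      by (simp only: add_0_left) algebra
    then show ?thesis by (simp only: xy[symmetric] s_def[symmetric])
  qed
  obtain K \<mu> where K: "\<And>z. z \<in> ball p r \<Longrightarrow> F z / f z = K * exp (\<mu> * z)"
  proof (rule midpoint_multiplicative_imp_exponential[of "ball p r" "\<lambda>z. F z / f z"])
    fix x y assume xy: "x \<in> ball p r" "y \<in> ball p r"
    then have "(x + y) / 2 \<in> ball p r"
      using convexD[OF convex_ball xy, of "1 / 2" "1 / 2"]
      by (simp add: scaleR_conv_of_real add_divide_distrib)
    then show "F x / f x * (F y / f y) = (F ((x + y) / 2) / f ((x + y) / 2)) ^ 2"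
      using mid[of x y] xy r by (auto simp: divide_simps subset_iff)
  qed (use r in \<open>auto intro!: holomorphic_intros hol hol'\<close>)
  have F: "F z = K * exp (\<mu> * z) * f z" for z
    by (rule analytic_continuation_open[of "ball p r" UNIV])
       (use r K in \<open>auto intro!: holomorphic_intros hol hol' simp: field_simps subset_iff\<close>)
  have p1: "f (p + 1) = - f p" "F (p + 1) = - F p"
    using theta_one_one_add_one[of p \<tau>] theta_one_one_add_one[of "p - u" \<tau>]
    by (simp_all add: f_def F_def algebra_simps)
  have "F p * exp \<mu> = F p"
    using p1(2) unfolding F p1(1) by (auto simp: exp_add ring_distribs)
  then have "exp \<mu> = 1" using p by simp
  then obtain n where n: "\<mu> = of_int (2 * n) * of_real pi * \<i>"
    using exp_eq[of \<mu> 0] by auto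
  define e where "e = exp (2 * of_real pi * \<i> * (\<tau> / 2 + p + 1 / 2))"
  have ptau: "f p = e * f (p + \<tau>)" "F p = e * exp (- (2 * of_real pi * \<i> * u)) * F (p + \<tau>)"
  proof -
    show "f p = e * f (p + \<tau>)"
      unfolding f_def e_def by (rule theta_one_one_add_tau)
    have "F p = exp (2 * of_real pi * \<i> * (\<tau> / 2 + (p - u) + 1 / 2)) * f (p - u + \<tau>)"
      unfolding F_def f_def by (rule theta_one_one_add_tau)
    also have "exp (2 * of_real pi * \<i> * (\<tau> / 2 + (p - u) + 1 / 2)) =
        e * exp (- (2 * of_real pi * \<i> * u))"
      unfolding e_def exp_add[symmetric] by (rule arg_cong[of _ _ exp]) (simp add: ring_distribs)
    finally show "F p = e * exp (- (2 * of_real pi * \<i> * u)) * F (p + \<tau>)"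
      by (simp add: F_def algebra_simps)
  qed
  have "F p = exp (\<mu> * \<tau>) * exp (- (2 * of_real pi * \<i> * u)) * (K * exp (\<mu> * p) * (e * f (p + \<tau>)))"
  proof -
    have "F (p + \<tau>) = K * exp (\<mu> * p) * exp (\<mu> * \<tau>) * f (p + \<tau>)"
      by (simp add: F ring_distribs exp_add)
    then show ?thesis
      by (subst ptau(2)) (simp only: mult_ac)
  qed
  also have "K * exp (\<mu> * p) * (e * f (p + \<tau>)) = F p"
    by (simp only: F ptau(1)[symmetric])
  finally have "exp (\<mu> * \<tau> + - (2 * of_real pi * \<i> * u)) = 1"
    using p by (simp only: exp_add) simp
  then obtain m where "\<mu> * \<tau> + - (2 * of_real pi * \<i> * u) = of_int (2 * m) * of_real pi * \<i>"
    using exp_eq[of "\<mu> * \<tau> + - (2 * of_real pi * \<i> * u)" 0] by auto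
  then have "(2 * of_real pi * \<i>) * u = (2 * of_real pi * \<i>) * (of_int (- m) + of_int n * \<tau>)"
    unfolding n by (simp add: algebra_simps)
  then have "u = of_int (- m) + of_int n * \<tau>"
    by (subst (asm) mult_cancel_left) simp
  then show ?thesis by (rule that)
qed

lemma theta_const_char_nonzero:
  assumes "Im \<tau> > 0" "(\<epsilon> - 1) / 2 \<notin> \<int>"
  shows "theta_const \<epsilon> \<epsilon>' \<tau> \<noteq> 0"
proof
  assume "theta_const \<epsilon> \<epsilon>' \<tau> = 0"
  then have "theta 1 1 ((of_real (\<epsilon> - 1) * \<tau> + of_real (\<epsilon>' - 1)) / 2) \<tau> = 0"
    using theta_char_add[of 1 "\<epsilon> - 1" 1 "\<epsilon>' - 1" 0 \<tau>] by (simp add: theta_const_def)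
  then obtain m n where "(of_real (\<epsilon> - 1) * \<tau> + of_real (\<epsilon>' - 1)) / 2 = of_int m + of_int n * \<tau>"
    by (rule theta_one_one_zero_in_lattice[OF assms(1)])
  then have "Im ((of_real (\<epsilon> - 1) * \<tau> + of_real (\<epsilon>' - 1)) / 2) = Im (of_int m + of_int n * \<tau>)"
    by (rule arg_cong)
  then have "(\<epsilon> - 1) / 2 = of_int n"
    using assms(1) by simp
  with assms(2) show False by simp
qed

section \<open>Logarithmic derivatives at points of order five\<close>

text \<open>
  Translating \<open>theta_tripling\<close> to characteristics: \<open>theta (1 - k * a) (1 - k * b)\<close> is an
  exponential factor times the translate of \<open>theta 1 1\<close> by \<open>- k * (a * \<tau> + b) / 2\<close>.
  The exponents of the factors are quadratic in \<open>k\<close> without constant term, and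
  \<open>3 * 2\<^sup>2 = 3 * 1\<^sup>2 + 3\<^sup>2\<close>, \<open>3 * 2 = 3 * 1 + 3\<close>, so all of them cancel. The derivatives of the
  factors contribute terms linear in \<open>k\<close>, which cancel because \<open>3 * 1 = 3\<close>.
\<close>

lemma theta_char_tripling:
  fixes a b :: real
  assumes "Im \<tau> > 0"
  defines "T \<equiv> \<lambda>k. theta_const (1 - k * a) (1 - k * b) \<tau>"
    and "T' \<equiv> \<lambda>k. theta_deriv (1 - k * a) (1 - k * b) \<tau>"
  shows "T 2 ^ 3 * theta_deriv 1 1 \<tau> = 3 * T 1 ^ 2 * T' 1 * T 3 - T 1 ^ 3 * T' 3"
proof -
  define f where "f = (\<lambda>z. theta 1 1 z \<tau>)"
  define x where "x = - (of_real a * \<tau> + of_real b) / 2"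
  define E where "E = (\<lambda>(k::real) z. exp (2 * of_real pi * \<i> *
    (of_real (- k * a) ^ 2 * \<tau> / 8 + of_real (- k * a) / 2 * (z + of_real (1 + - k * b) / 2))))"
  note D = theta_has_field_derivative[OF assms(1), of 1 1, folded f_def]
  have translate: "theta (1 - k * a) (1 - k * b) z \<tau> = E k z * f (z + of_real k * x)" for k z
  proof -
    have "z + (of_real (- k * a) * \<tau> + of_real (- k * b)) / 2 = z + of_real k * x"
      by (simp add: x_def ring_distribs diff_divide_distrib)
    then show ?thesis
      using theta_char_add[of 1 "- k * a" 1 "- k * b" z \<tau>] by (simp add: E_def f_def)
  qed
  have T: "T k = E k 0 * f (of_real k * x)" for k
    unfolding T_def theta_const_def translate by simp
  have T': "T' k = E k 0 * (deriv f (of_real k * x) - of_real pi * \<i> * of_real (k * a) * f (of_real k * x))" for k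
  proof -
    have "((\<lambda>z. E k z * f (z + of_real k * x)) has_field_derivative
        E k 0 * (deriv f (of_real k * x) - of_real pi * \<i> * of_real (k * a) * f (of_real k * x))) (at 0)"
      unfolding E_def by (rule derivative_eq_intros DERIV_chain2[OF D] refl | simp add: algebra_simps)+
    then show ?thesis
      unfolding T'_def theta_deriv_def translate by (rule DERIV_imp_deriv)
  qed
  have "E 2 0 ^ 3 = E 1 0 ^ 3 * E 3 0"
    unfolding E_def exp_of_nat_mult[symmetric] exp_add[symmetric]
    by (rule arg_cong[of _ _ exp]) (simp add: power2_eq_square ring_distribs add_divide_distrib diff_divide_distrib)
  moreover have "f (2 * x) ^ 3 * deriv f 0 =
      3 * f x ^ 2 * deriv f x * f (3 * x) - f x ^ 3 * deriv f (3 * x)"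
    unfolding f_def by (rule theta_tripling[OF assms(1)])
  moreover have "theta_deriv 1 1 \<tau> = deriv f 0"
    by (simp add: theta_deriv_def f_def)
  moreover have "T' 1 = E 1 0 * (deriv f x - of_real pi * \<i> * of_real a * f x)"
    "T' 3 = E 3 0 * (deriv f (3 * x) - 3 * of_real pi * \<i> * of_real a * f (3 * x))"
    "T 1 = E 1 0 * f x" "T 2 = E 2 0 * f (2 * x)" "T 3 = E 3 0 * f (3 * x)"
    using T[of 1] T[of 2] T[of 3] T'[of 1] T'[of 3] by simp_all
  ultimately show ?thesis
    by (simp only: power_mult_distrib) algebra
qed

lemma theta_const_uminus_char: "theta_const (- \<epsilon>) (- \<epsilon>') \<tau> = theta_const \<epsilon> \<epsilon>' \<tau>"
  by (simp add: theta_const_def theta_uminus_char)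

lemma theta_deriv_uminus_char:
  assumes "Im \<tau> > 0"
  shows "theta_deriv (- \<epsilon>) (- \<epsilon>') \<tau> = - theta_deriv \<epsilon> \<epsilon>' \<tau>"
proof -
  have "((\<lambda>z. theta \<epsilon> \<epsilon>' (- z) \<tau>) has_field_derivative
      deriv (\<lambda>z. theta \<epsilon> \<epsilon>' z \<tau>) (- 0) * (- 1)) (at 0)"
    by (rule DERIV_chain2[OF theta_has_field_derivative[OF assms]]) (auto intro!: derivative_eq_intros)
  then show ?thesis
    by (simp add: theta_deriv_def theta_uminus_char DERIV_imp_deriv)
qed

lemma theta_char_add_two_two:
  "theta (\<epsilon> + 2) (\<epsilon>' + 2) z \<tau> = exp (of_real (pi * \<epsilon>) * \<i>) * theta \<epsilon> \<epsilon>' z \<tau>"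
  by (subst theta_char_add_two) (rule theta_char_add_two')

lemma theta_deriv_char_add_two_two:
  assumes "Im \<tau> > 0"
  shows "theta_deriv (\<epsilon> + 2) (\<epsilon>' + 2) \<tau> = exp (of_real (pi * \<epsilon>) * \<i>) * theta_deriv \<epsilon> \<epsilon>' \<tau>"
  unfolding theta_deriv_def theta_char_add_two_two
  by (intro DERIV_imp_deriv DERIV_cmult theta_has_field_derivative assms)

theorem theorem4p1:
  fixes \<tau> :: complex
  assumes "Im \<tau> > 0"
  shows "theta_deriv (1/5) (1/5) \<tau> / theta_const (1/5) (1/5) \<tau> =
           theta_deriv 1 1 \<tau> *
           ((theta_const (1/5) (1/5) \<tau> ^ 5 - 3 * zeta_root 5 ^ 4 * theta_const (3/5) (3/5) \<tau> ^ 5)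
            / (10 * theta_const (1/5) (1/5) \<tau> ^ 3 * theta_const (3/5) (3/5) \<tau> ^ 3)) \<and>
         theta_deriv (3/5) (3/5) \<tau> / theta_const (3/5) (3/5) \<tau> =
           theta_deriv 1 1 \<tau> *
           ((3 * theta_const (1/5) (1/5) \<tau> ^ 5 + zeta_root 5 ^ 4 * theta_const (3/5) (3/5) \<tau> ^ 5)
            / (10 * theta_const (1/5) (1/5) \<tau> ^ 3 * theta_const (3/5) (3/5) \<tau> ^ 3))"
proof -
  define A A' where "A = theta_const (1/5) (1/5) \<tau>" and "A' = theta_deriv (1/5) (1/5) \<tau>"
  define B B' where "B = theta_const (3/5) (3/5) \<tau>" and "B' = theta_deriv (3/5) (3/5) \<tau>"
  \<comment> \<open>The tripling identity at \<open>1/5 = 1 - 4/5\<close> involves the characteristics \<open>1 - 2 * 4/5 = - 3/5\<close> and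
    \<open>1 - 3 * 4/5 = - 7/5\<close>.\<close>
  define C C' where "C = theta_const (- 7/5) (- 7/5) \<tau>" and "C' = theta_deriv (- 7/5) (- 7/5) \<tau>"
  define \<theta> where "\<theta> = theta_deriv 1 1 \<tau>"
  define \<zeta> where "\<zeta> = zeta_root 5 ^ 4"
  have not_Int: "- 2 / 5 \<notin> (\<int> :: real set)" "- 1 / 5 \<notin> (\<int> :: real set)"
    using of_int_div_of_int_in_Ints_iff[of "- 2" 5, where ?'a = real]
      of_int_div_of_int_in_Ints_iff[of "- 1" 5, where ?'a = real]
    by simp_all
  have nonzero: "A \<noteq> 0" "B \<noteq> 0"
    unfolding A_def B_def by (rule theta_const_char_nonzero[OF assms]; use not_Int in simp)+
  \<comment> \<open>\<open>8/5 = - 7/5 + 3\<close>: the odd number of half turns is the sign in front of \<open>\<zeta>\<close>.\<close>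
  have "\<zeta> = exp (of_real (pi * (- 7/5)) * \<i> + (of_real pi * \<i> + 2 * of_real pi * \<i>))"
    unfolding \<zeta>_def zeta_root_def exp_of_nat_mult[symmetric]
    by (rule arg_cong[of _ _ exp]) simp
  then have "exp (of_real (pi * (- 7/5)) * \<i>) = - \<zeta>"
    unfolding exp_add by simp
  then have C: "B = - \<zeta> * C" "B' = - \<zeta> * C'"
    using theta_char_add_two_two[of "- 7/5" "- 7/5" 0 \<tau>]
      theta_deriv_char_add_two_two[OF assms, of "- 7/5" "- 7/5"]
    by (simp_all add: B_def B'_def C_def C'_def theta_const_def)
  have first: "A ^ 3 * \<theta> = 3 * B\<^sup>2 * B' * A + B ^ 3 * A'"
    using theta_char_tripling[OF assms, of "2/5" "2/5"]
      theta_const_uminus_char[of "1/5" "1/5" \<tau>] theta_deriv_uminus_char[OF assms, of "1/5" "1/5"]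
    by (simp add: A_def A'_def B_def B'_def \<theta>_def)
  have "B ^ 3 * \<theta> = 3 * A\<^sup>2 * A' * C - A ^ 3 * C'"
    using theta_char_tripling[OF assms, of "4/5" "4/5"] theta_const_uminus_char[of "3/5" "3/5" \<tau>]
    by (simp add: A_def A'_def B_def C_def C'_def \<theta>_def)
  then have second: "\<zeta> * B ^ 3 * \<theta> = A ^ 3 * B' - 3 * A\<^sup>2 * A' * B"
    unfolding C by algebra
  have "A' * (10 * A ^ 3 * B ^ 3) = \<theta> * (A ^ 5 - 3 * \<zeta> * B ^ 5) * A"
    using first second by algebra
  moreover have "B' * (10 * A ^ 3 * B ^ 3) = \<theta> * (3 * A ^ 5 + \<zeta> * B ^ 5) * B"
    using first second by algebra
  ultimately have "A' / A = \<theta> * ((A ^ 5 - 3 * \<zeta> * B ^ 5) / (10 * A ^ 3 * B ^ 3)) \<and>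
      B' / B = \<theta> * ((3 * A ^ 5 + \<zeta> * B ^ 5) / (10 * A ^ 3 * B ^ 3))"
    using nonzero unfolding times_divide_eq_right by (subst (1 2) frac_eq_eq) simp_all
  then show ?thesis
    unfolding A_def A'_def B_def B'_def \<theta>_def \<zeta>_def .
qed

end
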